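(* Let $A=(a_{ij})$ be an $n\times n$ real matrix such that $D(A)\in\mathcal{D}$. Assume that $D(A)$ is strongly connected and that $\Delta_A\neq 0$. Let $A^{\#}=(\alpha_{ij})$ be the group inverse of $A$. Then $\alpha_{ij}=\dfrac{\mu_{ij}}{\Delta_A}$ for all $i,j\in\{1,\dots,n\}$.
   Context: The group inverse $A^{\#}$ of a real square matrix $A$ is, if it exists, the unique matrix $X$ with $AXA=A$, $XAX=X$, $AX=XA$ (under the hypotheses of the claim it exists). For $A=(a_{ij})\in\mathbb{R}^{n\times n}$, $D(A)$ is the digraph with vertex set $\{1,\dots,n\}$ in which $(i,j)$ is an edge iff $a_{ij}\neq 0$. A digraph is simple symmetric if it has no loops and, whenever $(i,j)$ is an edge, $(j,i)$ is also an edge. It is strongly connected if there is a (directed) path from each vertex to every other vertex. In a simple symmetric digraph, a 2-cycle $(i,j,i)$ (identified with $(j,i,j)$) is present for each pair of distinct vertices $i,j$ joined by edges; such $i,j$ are called adjacent and the 2-cycle is incident to $i$ and $j$. A vertex is pendant if it is incident to exactly one 2-cycle, and non-pendant otherwise. $\mathcal{D}$ is the class of simple symmetric digraphs in which each non-pendant vertex is adjacent to at least one pendant vertex. A matching is a set of pairwise vertex-disjoint 2-cycles; a maximum matching is a matching of maximum cardinality. The cycle product of $(i,j,i)$ is $a_{ij}a_{ji}$. For a maximum matching $M$, $\eta(M)$ is the product of the cycle products of all 2-cycles in $M$. $\Delta_A=\sum_M\eta(M)$, the sum over all maximum matchings $M$ of $D(A)$. A cycle chain $C_m(i_1,i_{m+1})$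 of length $m\ge 1$ from $i_1$ to $i_{m+1}$ is a sequence of 2-cycles $((i_1,i_2,i_1),(i_2,i_3,i_2),\dots,(i_m,i_{m+1},i_m))$ with $i_1,\dots,i_{m+1}$ distinct. It is alternating with respect to a maximum matching $M$ if its 2-cycles belong alternately to $M$ and to the complement of $M$, with the first and the last 2-cycle both in $M$ (so $m$ is odd). Its path product is $P_m(i_1,i_{m+1})=a_{i_1i_2}a_{i_2i_3}\cdots a_{i_mi_{m+1}}$. $\mathbb{M}(i,j)$ is the set of maximum matchings $M$ for which there is a cycle chain from $i$ to $j$ that is alternating with respect to $M$. Distinct vertices $i,j$ are maximally matchable if $\mathbb{M}(i,j)\neq\emptyset$; for $D(A)\in\mathcal{D}$ strongly connected, the alternating cycle chain $C_m(i,j)$ is then unique (independent of $M$). For $i,j$ maximally matchable and $M\in\mathbb{M}(i,j)$, $\beta_{\overline{i,j}}(M)$ is the product of the cycle products of all 2-cycles of $M$ not contained in $C_m(i,j)$ (empty product $=1$). Set $\beta_{ij}=(-1)^{\frac{m-1}{2}}P_m(i,j)$ if $i,j$ are maximally matchable (with $m$ the length of the alternating cycle chain $C_m(i,j)$), and $\beta_{ij}=0$ otherwise. Finally $\mu_{ij}=\beta_{ij}\cdot\sum_{M\in\mathbb{M}(i,j)}\beta_{\overline{i,j}}(M)$; thus $\mu_{ij}=0$ if $i,j$ are not maximally matchable, including the case $i=j$. *)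

theory Defs
  imports "HOL-Analysis.Analysis" "Graph_Theory.Graph_Theory"
begin

section \<open>Group inverse\<close>

definition is_group_inverse :: "real^'n^'n \<Rightarrow> real^'n^'n \<Rightarrow> bool" where
  "is_group_inverse A X \<longleftrightarrow> A ** X ** A = A \<and> X ** A ** X = X \<and> A ** X = X ** A"

definition group_inverse :: "real^'n^'n \<Rightarrow> real^'n^'n" where
  "group_inverse A = (THE X. is_group_inverse A X)"

section \<open>Digraphs, 2-cycles and matchings\<close>

text \<open>The vertices \<open>1, \<dots>, n\<close> are the elements of the finite index type \<open>'n\<close>.\<close>

definition matrix_digraph :: "real^'n^'n \<Rightarrow> 'n pair_pre_digraph" where
  "matrix_digraph A = \<lparr> pverts = UNIV, parcs = {(i, j). A $ i $ j \<noteq> 0} \<rparr>"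

text \<open>
  The 2-cycle \<open>(i,j,i)\<close>, which is identified with \<open>(j,i,j)\<close>, is represented by the
  unordered pair \<open>{i,j}\<close>.
\<close>

definition two_cycles :: "'v pair_pre_digraph \<Rightarrow> 'v set set" where
  "two_cycles G = {{i, j} | i j. i \<noteq> j \<and> (i, j) \<in> parcs G \<and> (j, i) \<in> parcs G}"

definition adjacent :: "'v pair_pre_digraph \<Rightarrow> 'v \<Rightarrow> 'v \<Rightarrow> bool" where
  "adjacent G i j \<longleftrightarrow> {i, j} \<in> two_cycles G"

definition pendant :: "'v pair_pre_digraph \<Rightarrow> 'v \<Rightarrow> bool" where
  "pendant G v \<longleftrightarrow> card {c \<in> two_cycles G. v \<in> c} = 1"

text \<open>
  The class \<open>\<D>\<close>. The locale predicate \<open>pair_graph\<close> says that the digraph is loop-free,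
  symmetric and finite (the last being automatic for \<open>matrix_digraph\<close>).
\<close>

definition class_D :: "'v pair_pre_digraph \<Rightarrow> bool" where
  "class_D G \<longleftrightarrow> pair_graph G \<and>
     (\<forall>v \<in> pverts G. \<not> pendant G v \<longrightarrow> (\<exists>u \<in> pverts G. adjacent G v u \<and> pendant G u))"

definition is_matching :: "'v pair_pre_digraph \<Rightarrow> 'v set set \<Rightarrow> bool" where
  "is_matching G M \<longleftrightarrow> M \<subseteq> two_cycles G \<and> pairwise disjnt M"

definition maximum_matching :: "'v pair_pre_digraph \<Rightarrow> 'v set set \<Rightarrow> bool" where
  "maximum_matching G M \<longleftrightarrow> is_arg_max card (is_matching G) M"

text \<open>Written so as to be symmetric in the two vertices of the 2-cycle \<open>c\<close>.\<close>

definition cycle_product :: "real^'n^'n \<Rightarrow> 'n set \<Rightarrow> real" where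
  "cycle_product A c = (\<Prod>i\<in>c. \<Prod>j\<in>c - {i}. A $ i $ j)"

lemma cycle_product_doubleton:
  "i \<noteq> j \<Longrightarrow> cycle_product A {i, j} = A $ i $ j * A $ j $ i"
  by (simp add: cycle_product_def insert_Diff_if)

definition matching_product :: "real^'n^'n \<Rightarrow> 'n set set \<Rightarrow> real" where
  "matching_product A M = (\<Prod>c\<in>M. cycle_product A c)"

definition Delta :: "real^'n^'n \<Rightarrow> real" where
  "Delta A = (\<Sum>M | maximum_matching (matrix_digraph A) M. matching_product A M)"

section \<open>Alternating cycle chains\<close>

text \<open>
  A cycle chain \<open>((i\<^sub>1,i\<^sub>2,i\<^sub>1), \<dots>, (i\<^sub>m,i\<^sub>m\<^sub>+\<^sub>1,i\<^sub>m))\<close> is represented by the list of arcs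
  \<open>[(i\<^sub>1,i\<^sub>2), \<dots>, (i\<^sub>m,i\<^sub>m\<^sub>+\<^sub>1)]\<close>; the reverse arcs are present too, since the digraphs considered are
  symmetric. Thus its length \<open>m\<close> is the length of the list.
\<close>

definition cycle_chain :: "'v pair_pre_digraph \<Rightarrow> 'v \<Rightarrow> ('v \<times> 'v) list \<Rightarrow> 'v \<Rightarrow> bool" where
  "cycle_chain G i p j \<longleftrightarrow> pre_digraph.apath (with_proj G) i p j \<and> p \<noteq> []"

definition arc_cycle :: "'v \<times> 'v \<Rightarrow> 'v set" where
  "arc_cycle e = {fst e, snd e}"

definition alternating :: "'v set set \<Rightarrow> ('v \<times> 'v) list \<Rightarrow> bool" where
  "alternating M p \<longleftrightarrow> arc_cycle (hd p) \<in> M \<and> arc_cycle (last p) \<in> M \<and>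
     (\<forall>k. Suc k < length p \<longrightarrow> (arc_cycle (p ! k) \<in> M \<longleftrightarrow> arc_cycle (p ! Suc k) \<notin> M))"

definition alternating_chain ::
    "'v pair_pre_digraph \<Rightarrow> 'v set set \<Rightarrow> 'v \<Rightarrow> ('v \<times> 'v) list \<Rightarrow> 'v \<Rightarrow> bool" where
  "alternating_chain G M i p j \<longleftrightarrow> cycle_chain G i p j \<and> alternating M p"

definition matchings_between :: "'v pair_pre_digraph \<Rightarrow> 'v \<Rightarrow> 'v \<Rightarrow> 'v set set set" where
  "matchings_between G i j = {M. maximum_matching G M \<and> (\<exists>p. alternating_chain G M i p j)}"

definition maximally_matchable :: "'v pair_pre_digraph \<Rightarrow> 'v \<Rightarrow> 'v \<Rightarrow> bool" where
  "maximally_matchable G i j \<longleftrightarrow> i \<noteq> j \<and> matchings_between G i j \<noteq> {}"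

text \<open>
  The alternating cycle chain from \<open>i\<close> to \<open>j\<close>; for maximally matchable vertices of a strongly
  connected digraph in \<open>\<D>\<close> it is unique, and the same for all maximum matchings.
\<close>

definition the_chain :: "'v pair_pre_digraph \<Rightarrow> 'v \<Rightarrow> 'v \<Rightarrow> ('v \<times> 'v) list" where
  "the_chain G i j = (THE p. \<exists>M. maximum_matching G M \<and> alternating_chain G M i p j)"

definition path_product :: "real^'n^'n \<Rightarrow> ('n \<times> 'n) list \<Rightarrow> real" where
  "path_product A p = (\<Prod>e\<leftarrow>p. A $ fst e $ snd e)"

definition beta :: "real^'n^'n \<Rightarrow> 'n \<Rightarrow> 'n \<Rightarrow> real" where
  "beta A i j =
     (if maximally_matchable (matrix_digraph A) i j
      then (let p = the_chain (matrix_digraph A) i j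
            in (-1) ^ ((length p - 1) div 2) * path_product A p)
      else 0)"

definition beta_bar :: "real^'n^'n \<Rightarrow> 'n \<Rightarrow> 'n \<Rightarrow> 'n set set \<Rightarrow> real" where
  "beta_bar A i j M =
     (\<Prod>c \<in> M - arc_cycle ` set (the_chain (matrix_digraph A) i j). cycle_product A c)"

definition mu :: "real^'n^'n \<Rightarrow> 'n \<Rightarrow> 'n \<Rightarrow> real" where
  "mu A i j = beta A i j * (\<Sum>M \<in> matchings_between (matrix_digraph A) i j. beta_bar A i j M)"

end

theory Submission
  imports Defs
begin

text \<open>
  Choose a set \<open>S\<close> of vertices containing the non-pendant vertices and one endpoint of every 2-cycle
  joining two pendant vertices. Each vertex outside \<open>S\<close> is a leaf attached to exactly one vertex
  \<open>r u\<close> of \<open>S\<close>, and each vertex of \<open>S\<close> carries a leaf. A maximum matching picks one leaf for each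
  vertex of \<open>S\<close>, so \<open>\<Delta>\<^sub>A\<close> is the product over \<open>s \<in> S\<close> of the sums \<open>d s\<close> of the cycle products of
  the 2-cycles between \<open>s\<close> and its leaves. Ordering \<open>S\<close> first, \<open>A\<close> has the block form
  \<open>[[T, B], [C, 0]]\<close> with \<open>B C\<close> the diagonal matrix \<open>D\<close> of the \<open>d s\<close>, and its group inverse is
  \<open>[[0, D\<^sup>-\<^sup>1 B], [C D\<^sup>-\<^sup>1, - C D\<^sup>-\<^sup>1 T D\<^sup>-\<^sup>1 B]]\<close>. Alternating chains have length 1 (a vertex of \<open>S\<close> and one
  of its leaves) or 3 (two leaves whose roots are adjacent), which are the three non-zero blocks.
\<close>

section \<open>Uniqueness of the group inverse\<close>

text \<open>Both \<open>A ** X\<close> and \<open>A ** Y\<close> equal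
  \<open>Y ** A ** X ** A\<close>, so they coincide, and then
  \<open>X = X ** A ** Y = Y\<close>.\<close>

lemma is_group_inverse_unique:
  assumes "is_group_inverse A X" "is_group_inverse A Y"
  shows "X = Y"
proof -
  have X: "A ** X ** A = A" "X ** A ** X = X" "A ** X = X ** A"
    and Y: "A ** Y ** A = A" "Y ** A ** Y = Y" "A ** Y = Y ** A"
    using assms by (auto simp: is_group_inverse_def)
  have "A ** X = (A ** Y) ** (A ** X)" by (simp add: matrix_mul_assoc Y(1))
  also have "\<dots> = (Y ** A) ** (X ** A)" unfolding X(3) Y(3) ..
  also have "\<dots> = Y ** (A ** X ** A)" by (simp add: matrix_mul_assoc)
  also have "\<dots> = A ** Y" by (simp only: X(1) Y(3))
  finally have AXY: "A ** X = A ** Y" .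
  have "X = X ** A ** Y" using X(2) by (metis AXY matrix_mul_assoc)
  also have "\<dots> = Y" using Y(2) by (metis AXY X(3) Y(3))
  finally show ?thesis .
qed

lemma group_inverse_eqI: "is_group_inverse A X \<Longrightarrow> group_inverse A = X"
  unfolding group_inverse_def by (blast intro: is_group_inverse_unique)

section \<open>Matrices whose digraph is covered by leaves\<close>

text \<open>All axioms concern the zero pattern of \<open>A\<close>, so they are stable under
  transposition. On \<open>S\<close> the values of \<open>r\<close> are arbitrary, hence the test
  \<open>u \<notin> S\<close> in \<open>leaves\<close>.\<close>

locale leaf_cover =
  fixes A :: "real^'n^'n" and S :: "'n set" and r :: "'n \<Rightarrow> 'n"
  assumes sym: "A $ i $ j \<noteq> 0 \<longleftrightarrow> A $ j $ i \<noteq> 0"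
    and loopfree: "A $ i $ i = 0"
    and leaf: "u \<notin> S \<Longrightarrow> A $ u $ j \<noteq> 0 \<longleftrightarrow> j = r u"
    and root: "u \<notin> S \<Longrightarrow> r u \<in> S"
    and leaf_exists: "s \<in> S \<Longrightarrow> \<exists>u. u \<notin> S \<and> r u = s"
begin

definition leaves :: "'n \<Rightarrow> 'n set" where
  "leaves s = {u. u \<notin> S \<and> r u = s}"

definition d :: "'n \<Rightarrow> real" where
  "d s = (\<Sum>u\<in>leaves s. A $ s $ u * A $ u $ s)"

text \<open>The vanishing block on \<open>S\<close> is hidden in the first test: a vertex of
  \<open>S\<close> is nobody's leaf.\<close>

definition X :: "real^'n^'n" where
  "X = (\<chi> i j. if i \<in> S
     then if j \<in> leaves i then A $ i $ j / d i else 0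
     else if j \<in> S then if i \<in> leaves j then A $ i $ j / d j else 0
     else - (A $ i $ r i * A $ r i $ r j * A $ r j $ j) / (d (r i) * d (r j)))"

text \<open>The common value of \<open>A ** X\<close> and \<open>X ** A\<close>.\<close>

definition E :: "real^'n^'n" where
  "E = (\<chi> i j. if i \<in> S then if i = j then 1 else 0
     else if j \<in> leaves (r i) then A $ i $ r i * A $ r i $ j / d (r i) else 0)"

section \<open>Products of the block matrices\<close>

lemma leaves_iff: "u \<in> leaves s \<longleftrightarrow> u \<notin> S \<and> r u = s"
  by (simp add: leaves_def)

lemma zero_leaf: "u \<notin> S \<Longrightarrow> j \<noteq> r u \<Longrightarrow> A $ u $ j = 0"
  "u \<notin> S \<Longrightarrow> j \<noteq> r u \<Longrightarrow> A $ j $ u = 0"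
  using leaf sym by blast+

lemma sum_leaf: "u \<notin> S \<Longrightarrow> (\<Sum>k\<in>UNIV. A $ u $ k * f k) = A $ u $ r u * f (r u)"
  using sum.mono_neutral_right[of UNIV "{r u}" "\<lambda>k. A $ u $ k * f k"] by (auto simp: zero_leaf)

lemma sum_core:
  assumes "s \<in> S"
  shows "(\<Sum>k\<in>UNIV. A $ s $ k * f k) = (\<Sum>k\<in>S. A $ s $ k * f k) + (\<Sum>u\<in>leaves s. A $ s $ u * f u)"
proof -
  have "(\<Sum>k\<in>UNIV. A $ s $ k * f k) = (\<Sum>k\<in>S \<union> leaves s. A $ s $ k * f k)"
    by (rule sum.mono_neutral_right) (auto simp: leaves_iff zero_leaf)
  also have "\<dots> = (\<Sum>k\<in>S. A $ s $ k * f k) + (\<Sum>u\<in>leaves s. A $ s $ u * f u)"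
    by (rule sum.union_disjoint) (auto simp: leaves_iff)
  finally show ?thesis .
qed

lemma transpose_leaf_cover: "leaf_cover (transpose A) S r"
  by unfold_locales (simp_all add: transpose_def sym loopfree root leaf_exists, metis sym leaf)

text \<open>This is \<open>B C = D\<close>; the factor \<open>c\<close>, constant over the leaves,
  stands last so that later sums can be brought into this form.\<close>

lemma sum_leaves_weight: "(\<Sum>u\<in>leaves s. A $ s $ u * (A $ u $ s * c)) = d s * c"
  by (simp add: d_def sum_distrib_right mult.assoc)

text \<open>Block multiplication: \<open>B C = D\<close> turns the upper left block into the
  identity and makes the two terms \<open>T D^-1 B\<close> of the upper right block cancel; the leaf
  rows give \<open>C D^-1 B\<close>.\<close>

lemma A_mult_X:
  assumes d: "\<And>s. s \<in> S \<Longrightarrow> d s \<noteq> 0"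
  shows "A ** X = E"
proof -
  have "(\<Sum>k\<in>UNIV. A $ i $ k * X $ k $ j) = E $ i $ j" for i j
  proof (cases "i \<in> S")
    case False
    then show ?thesis
      by (simp add: sum_leaf X_def E_def root)
  next
    case i: True
    show ?thesis
    proof (cases "j \<in> S")
      case True
      have "(\<Sum>u\<in>leaves i. A $ i $ u * X $ u $ j)
          = (\<Sum>u\<in>leaves i. if i = j then A $ i $ u * A $ u $ i / d i else 0)"
        using True by (intro sum.cong) (auto simp: X_def leaves_iff)
      also have "\<dots> = (if i = j then 1 else 0)"
        using d[OF i] by (auto simp: d_def simp flip: sum_divide_distrib)
      moreover have "(\<Sum>k\<in>S. A $ i $ k * X $ k $ j) = 0"
        using True by (intro sum.neutral) (auto simp: X_def leaves_iff)
      ultimately show ?thesis using i by (simp add: sum_core E_def)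
    next
      case False
      have "(\<Sum>u\<in>leaves i. A $ i $ u * X $ u $ j)
          = (\<Sum>u\<in>leaves i. A $ i $ u * (A $ u $ i * (- A $ i $ r j * A $ r j $ j / (d i * d (r j)))))"
        using False by (intro sum.cong) (auto simp: X_def leaves_iff)
      also have "\<dots> = - A $ i $ r j * A $ r j $ j / d (r j)"
        unfolding sum_leaves_weight using d i by simp
      \<comment> \<open>In column \<open>j\<close>, the only row of \<open>X\<close> indexed by
        \<open>S\<close> whose entry can be nonzero is that of the root of \<open>j\<close>.\<close>
      moreover have "(\<Sum>k\<in>S. A $ i $ k * X $ k $ j) = (\<Sum>k\<in>{r j}. A $ i $ k * X $ k $ j)"
        using False by (intro sum.mono_neutral_right) (auto simp: X_def leaves_iff root)
      ultimately show ?thesis using i False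
        by (auto simp add: sum_core E_def X_def root leaves_iff)
    qed
  qed
  then show ?thesis by (simp add: vec_eq_iff matrix_matrix_mult_def)
qed

text \<open>On \<open>S\<close> the matrix \<open>E\<close> acts as the identity; on the leaf rows
  the claim is \<open>C D^-1 B C = C\<close>.\<close>

lemma E_mult_A:
  assumes d: "\<And>s. s \<in> S \<Longrightarrow> d s \<noteq> 0"
  shows "E ** A = A"
proof -
  have "(\<Sum>k\<in>UNIV. E $ i $ k * A $ k $ j) = A $ i $ j" for i j
  proof (cases "i \<in> S")
    case True
    have "(\<Sum>k\<in>UNIV. E $ i $ k * A $ k $ j) = (\<Sum>k\<in>{i}. E $ i $ k * A $ k $ j)"
      using True by (intro sum.mono_neutral_right) (auto simp: E_def)
    then show ?thesis using True by (simp add: E_def)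
  next
    case False
    have "(\<Sum>k\<in>UNIV. E $ i $ k * A $ k $ j) = (\<Sum>k\<in>leaves (r i). E $ i $ k * A $ k $ j)"
      using False by (intro sum.mono_neutral_right) (auto simp: E_def)
    also have "\<dots> = (if j = r i then \<Sum>k\<in>leaves (r i). A $ r i $ k * (A $ k $ r i * (A $ i $ j / d (r i))) else 0)"
      using False by (auto simp: E_def leaves_iff zero_leaf intro!: sum.cong sum.neutral)
    also have "\<dots> = A $ i $ j"
      unfolding sum_leaves_weight using False d root by (auto simp: zero_leaf)
    finally show ?thesis .
  qed
  then show ?thesis by (simp add: vec_eq_iff matrix_matrix_mult_def)
qed

lemma E_mult_X:
  assumes d: "\<And>s. s \<in> S \<Longrightarrow> d s \<noteq> 0"
  shows "E ** X = X"
proof -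
  have "(\<Sum>k\<in>UNIV. E $ i $ k * X $ k $ j) = X $ i $ j" for i j
  proof (cases "i \<in> S")
    case True
    have "(\<Sum>k\<in>UNIV. E $ i $ k * X $ k $ j) = (\<Sum>k\<in>{i}. E $ i $ k * X $ k $ j)"
      using True by (intro sum.mono_neutral_right) (auto simp: E_def)
    then show ?thesis using True by (simp add: E_def)
  next
    case False
    \<comment> \<open>On the leaves of \<open>r i\<close>, column \<open>j\<close> of
      \<open>X\<close> is a multiple of column \<open>r i\<close> of \<open>A\<close>;
      \<open>c\<close> is the factor.\<close>
    define c where "c = (if j \<in> S then if j = r i then 1 / d j else 0
      else - (A $ r i $ r j * A $ r j $ j) / (d (r i) * d (r j)))"
    have X: "X $ k $ j = A $ k $ r i * c" if "k \<in> leaves (r i)" for k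
      using that by (auto simp: X_def c_def leaves_iff)
    have "(\<Sum>k\<in>UNIV. E $ i $ k * X $ k $ j) = (\<Sum>k\<in>leaves (r i). E $ i $ k * X $ k $ j)"
      using False by (intro sum.mono_neutral_right) (auto simp: E_def)
    also have "\<dots> = (\<Sum>k\<in>leaves (r i). A $ r i $ k * (A $ k $ r i * (A $ i $ r i / d (r i) * c)))"
      using False by (intro sum.cong) (auto simp: E_def X)
    also have "\<dots> = A $ i $ r i * c"
      unfolding sum_leaves_weight using False d root by auto
    also have "\<dots> = X $ i $ j" using False X by (simp add: leaves_iff)
    finally show ?thesis .
  qed
  then show ?thesis by (simp add: vec_eq_iff matrix_matrix_mult_def)
qed

text \<open>Transposition reverses the product, and the construction for \<open>transpose A\<close>
  yields the transposes of \<open>X\<close> and \<open>E\<close>, so \<open>A_mult_X\<close> for the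
  transpose applies.\<close>

lemma X_mult_A:
  assumes d: "\<And>s. s \<in> S \<Longrightarrow> d s \<noteq> 0"
  shows "X ** A = E"
proof -
  interpret t: leaf_cover "transpose A" S r by (rule transpose_leaf_cover)
  have td: "t.d = d"
    unfolding fun_eq_iff t.d_def d_def by (simp add: transpose_def mult.commute)
  have tX: "t.X = transpose X"
    unfolding t.X_def X_def td by (auto simp: vec_eq_iff leaves_iff transpose_def ac_simps)
  have tE: "t.E = transpose E"
    unfolding t.E_def E_def td by (auto simp: vec_eq_iff leaves_iff transpose_def)
  have "transpose (X ** A) = transpose E"
    using t.A_mult_X d by (simp add: matrix_transpose_mul td tX tE)
  then show ?thesis by (metis transpose_transpose)
qed

lemma is_group_inverse_X:
  assumes "\<And>s. s \<in> S \<Longrightarrow> d s \<noteq> 0"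
  shows "is_group_inverse A X"
  using A_mult_X[OF assms] X_mult_A[OF assms] E_mult_A[OF assms] E_mult_X[OF assms]
  by (simp add: is_group_inverse_def)

section \<open>Maximum matchings\<close>

abbreviation G :: "'n pair_pre_digraph" where
  "G \<equiv> matrix_digraph A"

lemma two_cycle_iff: "{i, j} \<in> two_cycles G \<longleftrightarrow> A $ i $ j \<noteq> 0"
  using sym loopfree by (auto simp: two_cycles_def matrix_digraph_def doubleton_eq_iff; metis)

text \<open>A vertex outside \<open>S\<close> has only its root as neighbour, so every 2-cycle meets
  \<open>S\<close>.\<close>

lemma two_cyclesE:
  assumes "c \<in> two_cycles G"
  obtains s x where "c = {s, x}" "s \<in> S" "A $ s $ x \<noteq> 0" "s \<noteq> x"
proof -
  obtain i j where ij: "c = {i, j}" "A $ i $ j \<noteq> 0" "i \<noteq> j"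
    using assms by (auto simp: two_cycles_def matrix_digraph_def)
  show thesis
  proof (cases "i \<in> S")
    case True then show ?thesis using that ij by blast
  next
    case False
    then have "j \<in> S" using leaf[of i j] root[of i] ij(2) by simp
    moreover have "A $ j $ i \<noteq> 0" using ij(2) sym by blast
    ultimately show ?thesis using that[of j i] ij(1,3) by (simp add: insert_commute)
  qed
qed

text \<open>The functions \<open>f\<close> of interest range over \<open>PiE S leaves\<close>, which
  fixes their values off \<open>S\<close>; otherwise \<open>f\<close> could not be recovered from
  its matching.\<close>

definition star_matching :: "('n \<Rightarrow> 'n) \<Rightarrow> 'n set set" where
  "star_matching f = (\<lambda>s. {s, f s}) ` S"

lemma inj_on_star:
  assumes "f \<in> PiE S leaves"
  shows "inj_on (\<lambda>s. {s, f s}) S"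
  using PiE_mem[OF assms] by (fastforce simp: inj_on_def doubleton_eq_iff leaves_iff)

lemma star_mem_iff:
  assumes "f \<in> PiE S leaves" "u \<notin> S"
  shows "{s, u} \<in> star_matching f \<longleftrightarrow> s \<in> S \<and> f s = u"
  using PiE_mem[OF assms(1)] assms(2)
  by (fastforce simp: star_matching_def doubleton_eq_iff leaves_iff image_iff)

lemma star_matching_is_matching:
  assumes "f \<in> PiE S leaves"
  shows "is_matching G (star_matching f)"
proof -
  have f: "f s \<notin> S" "r (f s) = s" if "s \<in> S" for s
    using PiE_mem[OF assms that] by (auto simp: leaves_iff)
  have "{s, f s} \<in> two_cycles G" if "s \<in> S" for s
    using f[OF that] leaf[of "f s" s] sym[of s "f s"] by (simp add: two_cycle_iff)
  moreover have "disjnt {s, f s} {t, f t}" if "s \<in> S" "t \<in> S" "s \<noteq> t" for s t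
    using f that by (metis disjnt_insert1 disjnt_empty1 insertE singletonD)
  ultimately show ?thesis
    unfolding is_matching_def star_matching_def pairwise_def by blast
qed

lemma card_star_matching: "f \<in> PiE S leaves \<Longrightarrow> card (star_matching f) = card S"
  by (simp add: star_matching_def card_image inj_on_star)

lemma star_exists: "\<exists>f. f \<in> PiE S leaves"
  using leaf_exists by (simp add: ex_in_conv PiE_eq_empty_iff) (auto simp: leaves_def)

text \<open>Every 2-cycle meets \<open>S\<close>, and disjoint ones do so in different vertices. The
  injection \<open>h\<close> bounds the size of a matching and is onto \<open>S\<close> when the
  bound is attained.\<close>

lemma matching_representatives:
  assumes "is_matching G M"
  obtains h where "inj_on h M" "h ` M \<subseteq> S" "\<And>c. c \<in> M \<Longrightarrow> h c \<in> c"
proof -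
  have "\<exists>s. s \<in> S \<and> s \<in> c" if "c \<in> M" for c
  proof -
    have "c \<in> two_cycles G" using that assms by (auto simp: is_matching_def)
    then show ?thesis by (rule two_cyclesE) blast
  qed
  then obtain h where h: "\<And>c. c \<in> M \<Longrightarrow> h c \<in> S \<and> h c \<in> c" by metis
  moreover have "inj_on h M"
  proof (rule inj_onI, rule ccontr)
    fix c c' assume "c \<in> M" "c' \<in> M" "h c = h c'" "c \<noteq> c'"
    then have "h c \<in> c" "h c \<in> c'" "disjnt c c'"
      using h[of c] h[of c'] assms by (auto simp: is_matching_def pairwise_def)
    then show False by (auto simp: disjnt_def)
  qed
  ultimately show thesis using that[of h] by blast
qed

lemma card_matching_le: "is_matching G M \<Longrightarrow> card M \<le> card S"
  by (metis matching_representatives card_inj_on_le finite)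

text \<open>
  A matching with \<open>card S\<close> elements covers every vertex of \<open>S\<close> by a different 2-cycle, so none of its
  2-cycles has both ends in \<open>S\<close>.
\<close>

lemma full_matching_is_star:
  assumes M: "is_matching G M" and card: "card M = card S"
  shows "\<exists>f\<in>PiE S leaves. M = star_matching f"
proof -
  obtain h where h: "inj_on h M" "h ` M \<subseteq> S" "\<And>c. c \<in> M \<Longrightarrow> h c \<in> c"
    using matching_representatives[OF M] by blast
  have img: "h ` M = S"
    using h card by (intro card_subset_eq) (auto simp: card_image)
  have "\<exists>x. x \<in> leaves s \<and> {s, x} \<in> M \<and> inv_into M h s = {s, x}" if s: "s \<in> S" for s
  proof -
    define c where "c = inv_into M h s"
    have c: "c \<in> M" "h c = s" using s img
      by (auto simp: c_def inv_into_into f_inv_into_f)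
    then have "s \<in> c" "c \<in> two_cycles G" using h M by (auto simp: is_matching_def)
    then obtain x where x: "c = {s, x}" "A $ s $ x \<noteq> 0" "s \<noteq> x"
      by (elim two_cyclesE) (use sym in auto)
    have "x \<notin> S"
    proof
      assume "x \<in> S"
      then obtain c' where c': "c' \<in> M" "h c' = x" using img by auto
      then have "x \<in> c'" "c' \<noteq> c" using h(3)[of c'] c x(3) by auto
      moreover have "disjnt c c'"
        using M c(1) c'(1) \<open>c' \<noteq> c\<close> by (auto simp: is_matching_def pairwise_def)
      ultimately show False using x(1) by (auto simp: disjnt_def)
    qed
    then have "x \<in> leaves s" using x(2) zero_leaf(2) by (metis leaves_iff)
    then show ?thesis using c x c_def by auto
  qed
  then obtain g where g: "\<And>s. s \<in> S \<Longrightarrow> g s \<in> leaves s \<and> {s, g s} \<in> M \<and> inv_into M h s = {s, g s}"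
    by metis
  have "M = inv_into M h ` S" using h(1) img by (metis inv_into_image_cancel subset_refl)
  also have "\<dots> = star_matching (restrict g S)" using g by (auto simp: star_matching_def)
  finally show ?thesis using g by (intro bexI[of _ "restrict g S"]) auto
qed

text \<open>Stars attain the upper bound \<open>card S\<close>, so the maximum matchings are those
  with \<open>card S\<close> elements, and these are stars.\<close>

lemma maximum_matching_iff:
  "maximum_matching G M \<longleftrightarrow> M \<in> star_matching ` PiE S leaves"
proof -
  have "maximum_matching G M \<longleftrightarrow> is_matching G M \<and> card M = card S"
    using star_exists star_matching_is_matching card_star_matching card_matching_le
    unfolding maximum_matching_def is_arg_max_def by (metis le_less not_less)
  then show ?thesis
    using full_matching_is_star star_matching_is_matching card_star_matching by auto
qed

lemma inj_on_star_matching: "inj_on star_matching (PiE S leaves)"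
proof (rule inj_onI)
  fix f g assume f: "f \<in> PiE S leaves" and g: "g \<in> PiE S leaves" and eq: "star_matching f = star_matching g"
  show "f = g"
  proof (rule PiE_ext[OF f g])
    fix s assume s: "s \<in> S"
    then have "f s \<notin> S" using PiE_mem[OF f] by (auto simp: leaves_iff)
    moreover from this have "{s, f s} \<in> star_matching g" using s star_mem_iff[OF f] eq by auto
    ultimately show "f s = g s" using star_mem_iff[OF g] by auto
  qed
qed

section \<open>Sums of products over maximum matchings\<close>

lemma cycle_product_star:
  "u \<in> leaves s \<Longrightarrow> s \<in> S \<Longrightarrow> cycle_product A {s, u} = A $ s $ u * A $ u $ s"
  by (rule cycle_product_doubleton) (auto simp: leaves_iff)

text \<open>Once the leaves on \<open>T\<close> are prescribed, the leaves at the vertices of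
  \<open>S - T\<close> are chosen independently, so the sum factorises by distributivity. Empty
  \<open>T\<close> gives \<open>Delta\<close>; one or two elements give the sums in
  \<open>mu\<close>.\<close>

lemma sum_maximum_matchings_extending:
  assumes T: "T \<subseteq> S" and g: "\<And>t. t \<in> T \<Longrightarrow> g t \<in> leaves t"
  shows "(\<Sum>M | maximum_matching G M \<and> (\<forall>t\<in>T. {t, g t} \<in> M).
            \<Prod>c \<in> M - (\<lambda>t. {t, g t}) ` T. cycle_product A c) = (\<Prod>s\<in>S - T. d s)"
proof -
  \<comment> \<open>A single admissible leaf of weight 1 on \<open>T\<close> encodes both the
    prescription and the removal of those 2-cycles, while the product still runs over all of
    \<open>S\<close>.\<close>
  define L where "L s = (if s \<in> T then {g s} else leaves s)" for s
  define w where "w s u = (if s \<in> T then 1 else A $ s $ u * A $ u $ s)" for s u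
  have sub: "PiE S L \<subseteq> PiE S leaves"
    by (rule PiE_mono) (auto simp: L_def g)
  have memL: "f t = g t" if "f \<in> PiE S L" "t \<in> T" for f t
    using PiE_mem[OF that(1), of t] that T by (auto simp: L_def)
  have gS: "g t \<notin> S" if "t \<in> T" for t using g[OF that] by (simp add: leaves_iff)
  have eq: "{M. maximum_matching G M \<and> (\<forall>t\<in>T. {t, g t} \<in> M)} = star_matching ` PiE S L"
  proof (intro set_eqI iffI; clarsimp simp: maximum_matching_iff)
    fix f assume f: "f \<in> PiE S leaves" "\<forall>t\<in>T. {t, g t} \<in> star_matching f"
    then have "f t = g t" if "t \<in> T" for t using star_mem_iff[OF f(1) gS] that by blast
    then have "f \<in> PiE S L" using f(1) by (auto simp: L_def PiE_iff)
    then show "star_matching f \<in> star_matching ` PiE S L" by blast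
  next
    fix f assume f: "f \<in> PiE S L"
    then show "star_matching f \<in> star_matching ` PiE S leaves \<and> (\<forall>t\<in>T. {t, g t} \<in> star_matching f)"
      using sub T memL[OF f] by (auto simp: star_matching_def)
  qed
  have prod: "(\<Prod>c \<in> star_matching f - (\<lambda>t. {t, g t}) ` T. cycle_product A c) = (\<Prod>s\<in>S. w s (f s))"
    if f: "f \<in> PiE S L" for f
  proof -
    have f': "f \<in> PiE S leaves" using f sub by blast
    have "(\<lambda>t. {t, g t}) ` T = (\<lambda>t. {t, f t}) ` T" using memL[OF f] by auto
    then have "star_matching f - (\<lambda>t. {t, g t}) ` T = (\<lambda>s. {s, f s}) ` (S - T)"
      using inj_on_image_set_diff[OF inj_on_star[OF f'], of S T] T by (simp add: star_matching_def)
    then have "(\<Prod>c \<in> star_matching f - (\<lambda>t. {t, g t}) ` T. cycle_product A c)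
        = (\<Prod>s\<in>S - T. cycle_product A {s, f s})"
      using inj_on_subset[OF inj_on_star[OF f'], of "S - T"] by (simp add: prod.reindex)
    also have "\<dots> = (\<Prod>s\<in>S - T. w s (f s))"
      using PiE_mem[OF f'] by (intro prod.cong) (auto simp: w_def cycle_product_star)
    also have "\<dots> = (\<Prod>s\<in>S. w s (f s))"
      by (rule prod.mono_neutral_left) (auto simp: w_def)
    finally show ?thesis .
  qed
  have "(\<Sum>M | maximum_matching G M \<and> (\<forall>t\<in>T. {t, g t} \<in> M).
            \<Prod>c \<in> M - (\<lambda>t. {t, g t}) ` T. cycle_product A c)
      = (\<Sum>f\<in>PiE S L. \<Prod>s\<in>S. w s (f s))"
    unfolding eq using inj_on_subset[OF inj_on_star_matching sub] prod
    by (simp add: sum.reindex)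
  also have "\<dots> = (\<Prod>s\<in>S. \<Sum>u\<in>L s. w s u)"
    by (rule prod_sum_PiE[symmetric]) auto
  also have "\<dots> = (\<Prod>s\<in>S - T. \<Sum>u\<in>L s. w s u)"
    by (rule prod.mono_neutral_right) (auto simp: w_def L_def)
  also have "\<dots> = (\<Prod>s\<in>S - T. d s)"
    by (rule prod.cong) (auto simp: w_def L_def d_def)
  finally show ?thesis .
qed

lemma Delta_eq: "Delta A = (\<Prod>s\<in>S. d s)"
  using sum_maximum_matchings_extending[of "{}"] by (simp add: Delta_def matching_product_def)

section \<open>Alternating cycle chains\<close>

text \<open>An inner vertex of a chain has two distinct neighbours, so this places it in
  \<open>S\<close>.\<close>

lemma pendant_core: "A $ x $ y \<noteq> 0 \<Longrightarrow> A $ x $ z \<noteq> 0 \<Longrightarrow> y \<noteq> z \<Longrightarrow> x \<in> S"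
  using leaf by metis

text \<open>A star joins vertices of \<open>S\<close> to leaves, so \<open>x \<in> S\<close> decides
  which end is which. In particular no matched 2-cycle lies inside \<open>S\<close>.\<close>

lemma maximum_matching_pair:
  assumes "maximum_matching G M" "{x, y} \<in> M" "x \<in> S"
  shows "y \<in> leaves x"
proof -
  obtain f s where f: "f \<in> PiE S leaves" and s: "s \<in> S" "{x, y} = {s, f s}"
    using assms(1,2) unfolding maximum_matching_iff star_matching_def by blast
  have "f s \<in> leaves s" using PiE_mem[OF f s(1)] .
  then show ?thesis using s(2) assms(3) by (metis doubleton_eq_iff leaves_iff)
qed

lemma cycle_chain_iff:
  "cycle_chain G i p j \<longleftrightarrow> p \<noteq> [] \<and> (\<forall>e\<in>set p. A $ fst e $ snd e \<noteq> 0) \<and> pcas i p j \<and> distinct (pawalk_verts i p)"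
  unfolding cycle_chain_def pre_digraph.apath_def pre_digraph.awalk_def
  by (auto simp: cas_with_proj_eq awalk_verts_with_proj_eq matrix_digraph_def)

text \<open>Inner vertices of a chain lie in \<open>S\<close>, and the matched partner of a vertex
  of \<open>S\<close> is a leaf. After three 2-cycles a leaf has been reached and the chain cannot
  go on.\<close>

lemma alternating_chain_iff:
  assumes M: "maximum_matching G M"
  shows "alternating_chain G M i p j \<longleftrightarrow>
    p = [(i, j)] \<and> {i, j} \<in> M \<or>
    p = [(i, r i), (r i, r j), (r j, j)] \<and> i \<notin> S \<and> j \<notin> S \<and> A $ r i $ r j \<noteq> 0
      \<and> {r i, i} \<in> M \<and> {r j, j} \<in> M" (is "?L \<longleftrightarrow> ?R")
proof
  assume ?L
  then have chain: "p \<noteq> []" "\<And>e. e \<in> set p \<Longrightarrow> A $ fst e $ snd e \<noteq> 0" "pcas i p j"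
      "distinct (pawalk_verts i p)" and alt: "alternating M p"
    by (auto simp: alternating_chain_def cycle_chain_iff)
  from chain(1) obtain e p1 where p1: "p = e # p1" by (cases p) auto
  show ?R
  proof (cases p1)
    case Nil
    then show ?thesis using chain alt p1 by (cases e) (auto simp: alternating_def arc_cycle_def)
  next
    case (Cons e1 p2)
    note p2 = this
    show ?thesis
    proof (cases p2)
      case Nil
      \<comment> \<open>Length two fails: consecutive 2-cycles would both be matched.\<close>
      then show ?thesis using alt p1 p2 by (auto simp: alternating_def)
    next
      case (Cons e2 q)
      note q = this
      from chain(3) p1 p2 q obtain x y z where p: "p = (i, x) # (x, y) # (y, z) # q"
        and q': "pcas z q j" by (cases e; cases e1; cases e2) auto
      have ix: "{i, x} \<in> M" using alt p by (simp add: alternating_def arc_cycle_def)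
      have step: "arc_cycle (p ! k) \<in> M \<longleftrightarrow> arc_cycle (p ! Suc k) \<notin> M" if "Suc k < length p" for k
        using alt that by (simp add: alternating_def)
      have yz: "{y, z} \<in> M"
        using step[of 0] step[of 1] ix p by (simp add: arc_cycle_def)
      have nz: "A $ i $ x \<noteq> 0" "A $ x $ y \<noteq> 0" "A $ y $ z \<noteq> 0"
        using chain(2) p by auto
      have dq: "distinct (i # x # y # pawalk_verts z q)" using chain(4) p by simp
      have zq: "z \<in> set (pawalk_verts z q)" using q' by (cases q) auto
      have dist: "i \<noteq> x" "i \<noteq> y" "x \<noteq> y" "x \<noteq> z" "y \<noteq> z"
        using dq zq by auto
      have xS: "x \<in> S" using pendant_core[of x i y] nz dist sym by blast
      have yS: "y \<in> S" using pendant_core[of y x z] nz dist sym by blast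
      have i: "i \<in> leaves x" using maximum_matching_pair[OF M, of x i] ix xS by (simp add: insert_commute)
      have z: "z \<in> leaves y" using maximum_matching_pair[OF M yz yS] .
      \<comment> \<open>The leaf \<open>z\<close> has \<open>y\<close> as its only neighbour,
        whereas a further arc would lead to some \<open>w\<close> different from
        \<open>y\<close>.\<close>
      have "q = []"
      proof (rule ccontr)
        assume "q \<noteq> []"
        then obtain w q2 where q2: "q = (z, w) # q2" using q' by (cases q) auto
        have "w \<in> set (pawalk_verts z q)" using q' q2 by (cases q2) auto
        then have "w \<noteq> y" using dq by auto
        moreover have "A $ z $ w \<noteq> 0" using chain(2) p q2 by auto
        ultimately have "z \<in> S" using pendant_core[of z y w] nz sym by blast
        then show False using z by (simp add: leaves_iff)
      qed
      then have "z = j" using q' by simp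
      then show ?thesis
        using \<open>q = []\<close> p i z nz ix yz by (auto simp: leaves_iff insert_commute)
    qed
  qed
next
  have cyc: "A $ x $ y \<noteq> 0" if "{x, y} \<in> M" for x y
  proof -
    have "{x, y} \<in> two_cycles G"
      using that M by (auto simp: maximum_matching_def is_arg_max_def is_matching_def)
    then show ?thesis by (simp add: two_cycle_iff)
  qed
  assume ?R
  then show ?L
  proof (elim disjE conjE)
    assume "p = [(i, j)]" "{i, j} \<in> M"
    then show ?L using cyc[of i j] loopfree
      by (auto simp: alternating_chain_def cycle_chain_iff alternating_def arc_cycle_def)
  next
    assume p: "p = [(i, r i), (r i, r j), (r j, j)]" and ij: "i \<notin> S" "j \<notin> S" "A $ r i $ r j \<noteq> 0"
      "{r i, i} \<in> M" "{r j, j} \<in> M"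
    have "r i \<noteq> r j" using ij loopfree by metis
    moreover have "r i \<in> S" "r j \<in> S" using ij root by auto
    \<comment> \<open>The middle 2-cycle lies inside \<open>S\<close> and is therefore unmatched, as
      alternation demands.\<close>
    moreover from this have "{r i, r j} \<notin> M"
      using maximum_matching_pair[OF M] by (auto simp: leaves_iff)
    moreover have "A $ i $ r i \<noteq> 0" using cyc[OF ij(4)] sym by blast
    ultimately show ?L using p ij cyc[OF ij(5)]
      by (auto simp: alternating_chain_def cycle_chain_iff alternating_def arc_cycle_def
          insert_commute nth_Cons split: nat.split)
  qed
qed

section \<open>Evaluation of \<open>mu\<close>\<close>

lemma maximum_matching_extending:
  assumes "T \<subseteq> S" and g: "\<And>t. t \<in> T \<Longrightarrow> g t \<in> leaves t"
  obtains M where "maximum_matching G M" "\<And>t. t \<in> T \<Longrightarrow> {t, g t} \<in> M"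
proof -
  obtain f0 where f0: "f0 \<in> PiE S leaves" using star_exists by blast
  define f where "f s = (if s \<in> T then g s else f0 s)" for s
  have "f \<in> PiE S leaves" using f0 assms by (auto simp: f_def PiE_iff extensional_def)
  moreover have "{t, g t} \<in> star_matching f" if "t \<in> T" for t
    using that assms(1) by (auto simp: star_matching_def f_def image_iff intro!: bexI[of _ t])
  ultimately show thesis using that maximum_matching_iff by blast
qed

text \<open>Isolates what both chain shapes share: \<open>p\<close> is the only possible chain, it
  alternates exactly when \<open>M\<close> has the prescribed pairs on \<open>T\<close>, and
  removing its 2-cycles from \<open>M\<close> removes just those pairs.\<close>

lemma mu_eqI:
  assumes T: "T \<subseteq> S" and g: "\<And>t. t \<in> T \<Longrightarrow> g t \<in> leaves t" and "i \<noteq> j"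
    and chain: "\<And>M q. maximum_matching G M \<Longrightarrow>
      alternating_chain G M i q j \<longleftrightarrow> q = p \<and> (\<forall>t\<in>T. {t, g t} \<in> M)"
    and rest: "\<And>M. maximum_matching G M \<Longrightarrow>
      M - arc_cycle ` set p = M - (\<lambda>t. {t, g t}) ` T"
  shows "mu A i j = (-1) ^ ((length p - 1) div 2) * path_product A p * (\<Prod>s\<in>S - T. d s)"
proof -
  \<comment> \<open>One witness makes \<open>i\<close> and \<open>j\<close> matchable and justifies
    the description in \<open>the_chain\<close>.\<close>
  obtain M0 where M0: "maximum_matching G M0" "\<And>t. t \<in> T \<Longrightarrow> {t, g t} \<in> M0"
    using maximum_matching_extending[OF T g] by blast
  have between: "matchings_between G i j = {M. maximum_matching G M \<and> (\<forall>t\<in>T. {t, g t} \<in> M)}"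
    using chain by (auto simp: matchings_between_def)
  then have matchable: "maximally_matchable G i j"
    using M0 \<open>i \<noteq> j\<close> by (auto simp: maximally_matchable_def)
  have the: "the_chain G i j = p"
    unfolding the_chain_def using chain M0 by (intro the_equality) blast+
  have "(\<Sum>M\<in>matchings_between G i j. beta_bar A i j M)
    = (\<Sum>M | maximum_matching G M \<and> (\<forall>t\<in>T. {t, g t} \<in> M).
        \<Prod>c \<in> M - (\<lambda>t. {t, g t}) ` T. cycle_product A c)"
    unfolding between by (intro sum.cong) (auto simp: beta_bar_def the rest)
  then show ?thesis
    using matchable sum_maximum_matchings_extending[OF T g]
    by (simp add: mu_def beta_def the)
qed

lemma mu_leaf:
  assumes u: "u \<in> leaves s" and s: "s \<in> S" and ij: "i = s \<and> j = u \<or> i = u \<and> j = s"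
  shows "mu A i j = A $ i $ j * (\<Prod>t\<in>S - {s}. d t)"
proof -
  \<comment> \<open>One end lies in \<open>S\<close>, which excludes chains of length three.\<close>
  have "\<not> (i \<notin> S \<and> j \<notin> S)" and ne: "i \<noteq> j" and eq: "{i, j} = {s, u}"
    using assms by (auto simp: leaves_iff)
  then have chain: "alternating_chain G M i q j \<longleftrightarrow> q = [(i, j)] \<and> {s, u} \<in> M"
    if "maximum_matching G M" for M q
    using alternating_chain_iff[OF that, of i q j] unfolding eq by blast
  have "mu A i j = (-1) ^ ((length [(i, j)] - 1) div 2) * path_product A [(i, j)] * (\<Prod>t\<in>S - {s}. d t)"
  proof (rule mu_eqI[where g = "\<lambda>_. u"])
    show "M - arc_cycle ` set [(i, j)] = M - (\<lambda>t. {t, u}) ` {s}" for M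
      using eq by (simp add: arc_cycle_def)
  qed (use u s ne chain in auto)
  then show ?thesis by (simp add: path_product_def)
qed

text \<open>The chain runs leaf, root, root, leaf: length 3 gives the minus sign, and its outer
  2-cycles prescribe the leaf at both roots.\<close>

lemma mu_leaves:
  assumes ij: "i \<notin> S" "j \<notin> S" and edge: "A $ r i $ r j \<noteq> 0"
  shows "mu A i j = - (A $ i $ r i * A $ r i $ r j * A $ r j $ j) * (\<Prod>t\<in>S - {r i, r j}. d t)"
proof -
  let ?p = "[(i, r i), (r i, r j), (r j, j)]"
  let ?g = "\<lambda>t. if t = r i then i else j"
  have ne: "r i \<noteq> r j" "i \<noteq> j" using edge loopfree by metis+
  have S: "r i \<in> S" "r j \<in> S" using ij root by auto
  \<comment> \<open>Being unmatched, the middle 2-cycle changes nothing when removed from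
    \<open>M\<close>.\<close>
  have core: "{r i, r j} \<notin> M" if "maximum_matching G M" for M
    using maximum_matching_pair[OF that _ S(1), of "r j"] S(2) by (auto simp: leaves_iff)
  \<comment> \<open>This excludes the chain of length one.\<close>
  have pair: "{i, j} \<notin> M" if "maximum_matching G M" for M
    using that ij by (auto simp: maximum_matching_iff star_matching_def doubleton_eq_iff)
  have "mu A i j = (-1) ^ ((length ?p - 1) div 2) * path_product A ?p * (\<Prod>t\<in>S - {r i, r j}. d t)"
  proof (rule mu_eqI[where g = ?g])
    fix M assume M: "maximum_matching G M"
    show "alternating_chain G M i q j \<longleftrightarrow> q = ?p \<and> (\<forall>t\<in>{r i, r j}. {t, ?g t} \<in> M)" for q
      unfolding alternating_chain_iff[OF M] using ne ij edge pair[OF M] by auto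
    show "M - arc_cycle ` set ?p = M - (\<lambda>t. {t, ?g t}) ` {r i, r j}"
      using ne core[OF M] by (auto simp: arc_cycle_def insert_commute)
  qed (use ij S ne in \<open>auto simp: leaves_iff\<close>)
  then show ?thesis by (simp add: path_product_def)
qed

text \<open>The hypotheses rule out both shapes of alternating chain. The diagonal falls under them
  too, since \<open>r i\<close> carries no loop.\<close>

lemma mu_zero:
  assumes "j \<notin> leaves i \<or> i \<notin> S" "i \<notin> leaves j \<or> j \<notin> S"
    and "i \<in> S \<or> j \<in> S \<or> A $ r i $ r j = 0"
  shows "mu A i j = 0"
proof -
  have "{i, j} \<notin> M" if M: "maximum_matching G M" for M
    using assms(1,2) M by (auto simp: maximum_matching_iff star_matching_def doubleton_eq_iff)
  then have "matchings_between G i j = {}"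
    using assms(3) by (auto simp: matchings_between_def alternating_chain_iff)
  then show ?thesis by (simp add: mu_def)
qed

text \<open>By \<open>Delta_eq\<close> the quotient cancels all factors \<open>d s\<close> except
  those at the roots involved, which are the denominators in \<open>X\<close>.\<close>

lemma mu_eq_X:
  assumes Delta: "Delta A \<noteq> 0"
  shows "mu A i j / Delta A = X $ i $ j"
proof -
  have d: "d s \<noteq> 0" if "s \<in> S" for s using that Delta by (auto simp: Delta_eq)
  have one: "Delta A = d s * (\<Prod>t\<in>S - {s}. d t)" if "s \<in> S" for s
    unfolding Delta_eq by (rule prod.remove) (use that in auto)
  have two: "Delta A = d s * d t * (\<Prod>t\<in>S - {s, t}. d t)" if "s \<in> S" "t \<in> S" "s \<noteq> t" for s t
    using one[OF that(1)] prod.remove[of "S - {s}" t d] that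
    by (simp add: Diff_insert2[symmetric] insert_commute mult.assoc)
  consider "i \<in> S" "j \<in> leaves i" | "j \<in> S" "i \<in> leaves j"
    | "i \<notin> S" "j \<notin> S" "A $ r i $ r j \<noteq> 0"
    | "j \<notin> leaves i \<or> i \<notin> S" "i \<notin> leaves j \<or> j \<notin> S" "i \<in> S \<or> j \<in> S \<or> A $ r i $ r j = 0"
    by blast
  then show ?thesis
  proof cases
    case 1
    then show ?thesis using mu_leaf[of j i i j] one[of i] Delta by (simp add: X_def)
  next
    case 2
    then show ?thesis using mu_leaf[of i j i j] one[of j] Delta by (simp add: X_def leaves_iff)
  next
    case 3
    then have "r i \<noteq> r j" "r i \<in> S" "r j \<in> S" using loopfree root by metis+
    then show ?thesis using 3 mu_leaves[OF 3] two[of "r i" "r j"] Delta by (simp add: X_def)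
  next
    case 4
    then show ?thesis using mu_zero[OF 4] by (auto simp: X_def)
  qed
qed

lemma group_inverse_eq:
  assumes Delta: "Delta A \<noteq> 0"
  shows "(\<exists>!X. is_group_inverse A X) \<and> (\<forall>i j. group_inverse A $ i $ j = mu A i j / Delta A)"
proof -
  have "is_group_inverse A X"
    using Delta by (intro is_group_inverse_X) (auto simp: Delta_eq)
  then show ?thesis
    using group_inverse_eqI is_group_inverse_unique mu_eq_X[OF Delta] by metis
qed

end

section \<open>The class \<open>\<D>\<close>\<close>

text \<open>A non-pendant vertex goes into \<open>S\<close> and has a pendant neighbour as leaf;
  only a 2-cycle of two pendant vertices calls for a choice of end.\<close>

lemma class_D_leaf_cover:
  fixes A :: "real^'n^'n"
  assumes D: "class_D (matrix_digraph A)"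
  obtains S r where "leaf_cover A S r"
proof -
  let ?G = "matrix_digraph A"
  interpret pair_graph ?G using D by (simp add: class_D_def)
  have loop: "A $ i $ i = 0" for i
    using pair_no_loops[of "(i, i)"] by (auto simp: matrix_digraph_def)
  have sym: "A $ i $ j \<noteq> 0 \<longleftrightarrow> A $ j $ i \<noteq> 0" for i j
    using pair_sym_arcs unfolding symmetric_def by (auto simp: matrix_digraph_def sym_def)
  have adj: "adjacent ?G i j \<longleftrightarrow> A $ i $ j \<noteq> 0" for i j
    using sym loop by (auto simp: adjacent_def two_cycles_def matrix_digraph_def doubleton_eq_iff; metis)
  have pend: "pendant ?G u \<longleftrightarrow> (\<exists>!v. A $ u $ v \<noteq> 0)" for u
  proof -
    have "{c \<in> two_cycles ?G. u \<in> c} = (\<lambda>v. {u, v}) ` {v. A $ u $ v \<noteq> 0}"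
      using sym loop by (auto simp: two_cycles_def matrix_digraph_def image_iff; metis insert_commute)
    moreover have "inj_on (\<lambda>v. {u, v}) {v. A $ u $ v \<noteq> 0}"
      by (auto simp: inj_on_def doubleton_eq_iff)
    ultimately have "pendant ?G u \<longleftrightarrow> card {v. A $ u $ v \<noteq> 0} = 1"
      by (simp add: pendant_def card_image)
    then show ?thesis by (auto simp: card_1_singleton_iff set_eq_iff; metis)
  qed
  \<comment> \<open>\<open>SOME x. x \<in> {v, w}\<close> depends on the unordered pair only, so the
    two ends of a 2-cycle of pendant vertices agree on which of them enters
    \<open>S\<close>.\<close>
  define S where "S = {v. \<not> pendant ?G v \<or>
    (\<exists>w. A $ v $ w \<noteq> 0 \<and> pendant ?G w \<and> v = (SOME x. x \<in> {v, w}))}"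
  define r where "r u = (THE v. A $ u $ v \<noteq> 0)" for u
  have some: "(SOME x. x \<in> {v, w}) \<in> {v, w}" for v w :: 'n by (rule someI[of _ v]) simp
  have leaf: "A $ u $ j \<noteq> 0 \<longleftrightarrow> j = r u" if "pendant ?G u" for u j
    using that theI'[of "\<lambda>v. A $ u $ v \<noteq> 0"] unfolding pend r_def by blast
  have outside: "pendant ?G u" if "u \<notin> S" for u using that by (auto simp: S_def)
  have root: "r u \<in> S" if u: "u \<notin> S" for u
  proof (cases "pendant ?G (r u)")
    case True
    have "A $ u $ r u \<noteq> 0" using leaf outside[OF u] by blast
    \<comment> \<open>As \<open>u\<close> is outside \<open>S\<close>, the end chosen in
      \<open>{u, r u}\<close> must be \<open>r u\<close>.\<close>
    moreover from this have "u \<noteq> (SOME x. x \<in> {u, r u})" using u True by (auto simp: S_def)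
    then have "r u = (SOME x. x \<in> {r u, u})" using some[of u "r u"] by (auto simp: insert_commute)
    ultimately show ?thesis using outside[OF u] sym by (auto simp: S_def)
  qed (auto simp: S_def)
  have ex: "\<exists>u. u \<notin> S \<and> r u = s" if s: "s \<in> S" for s
  proof (cases "pendant ?G s")
    case False
    then obtain u where u: "A $ s $ u \<noteq> 0" "pendant ?G u"
      using D adj by (auto simp: class_D_def matrix_digraph_def)
    then have ru: "r u = s" using leaf sym by metis
    \<comment> \<open>The only neighbour \<open>s\<close> of \<open>u\<close> is non-pendant, so
      neither clause of \<open>S\<close> applies to \<open>u\<close>.\<close>
    then have "u \<notin> S" using u False leaf by (auto simp: S_def)
    then show ?thesis using ru by blast
  next
    case True
    then obtain w where w: "A $ s $ w \<noteq> 0" "pendant ?G w" "s = (SOME x. x \<in> {s, w})"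
      using s by (auto simp: S_def)
    then have rw: "r w = s" using leaf sym by metis
    have "w \<noteq> s" using w loop by metis
    \<comment> \<open>Otherwise \<open>w\<close> and \<open>s\<close> would both be the chosen end
      of the same pair.\<close>
    have "w \<notin> S"
    proof
      assume "w \<in> S"
      then obtain v where v: "A $ w $ v \<noteq> 0" "w = (SOME x. x \<in> {w, v})"
        using w(2) unfolding S_def by blast
      have "v = s" using v(1) leaf[OF w(2)] rw by simp
      then show False using v(2) w(3) \<open>w \<noteq> s\<close> by (metis insert_commute)
    qed
    then show ?thesis using rw by blast
  qed
  show thesis
    by (rule that[of S r], unfold_locales) (use sym loop leaf outside root ex in blast)+
qed

theorem theorem1p4:
  fixes A :: "real^'n^'n"
  assumes "class_D (matrix_digraph A)"
    and "strongly_connected (with_proj (matrix_digraph A))"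
    and "Delta A \<noteq> 0"
  shows "(\<exists>!X. is_group_inverse A X) \<and>
    (\<forall>i j. group_inverse A $ i $ j = mu A i j / Delta A)"
proof -
  obtain S r where "leaf_cover A S r" using class_D_leaf_cover[OF assms(1)] .
  then show ?thesis using assms(3) by (rule leaf_cover.group_inverse_eq)
qed

end
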